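(* Let $(\Omega,\mathcal{F},\mathbb{P})$ be a probability space, $n\in\mathbb{N}$, $I\subseteq(0,\infty)$ an interval, $E\subseteq L^\infty_{++}$ a GG-convex cone with $(0,\infty)\subseteq E$ (positive constants), and assume that $E_I=\{X\in E: X(\omega)\in I\ \text{a.s.}\}$ is a GG-convex cone. Let $\tilde\rho:E^n\to(0,\infty)$ be a map. (A) $\tilde\rho$ is a systemic return risk measure if and only if there exist maps $\tilde\rho_0:E_I\to(0,\infty)$ and $\tilde\Lambda:(0,\infty)^n\to I$ with $\tilde\rho=\tilde\rho_0\circ\tilde\Lambda$ such that $\tilde\Lambda$ is a return aggregation function, and $\tilde\rho_0$ is increasing and satisfies the constancy property on $I$, i.e. $\tilde\rho_0(x)=x$ for all constants $x\in I$. (B) $\tilde\rho$ is a GG-convex systemic return risk measure if and only if there exist such maps with $\tilde\rho=\tilde\rho_0\circ\tilde\Lambda$, where $\tilde\Lambda$ is a GG-convex return aggregation function, and $\tilde\rho_0$ is increasing, GG-convex and satisfies the constancy property on $I$. (C) $\tilde\rho$ is a GG-coherent systemic return risk measure if and only if there exist such maps with $\tilde\rho=\tilde\rho_0\circ\tilde\Lambda$, where $\tilde\Lambda$ is a GG-coherent return aggregation function, and $\tilde\rho_0$ is increasing, GG-convex, positively homogeneous and satisfies the constancy property on $I$.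
   Context: $L^\infty_{++}$ is the set of (classes of) essentially bounded real random variables $X$ with $X>0$ a.s. A set $C$ is a cone if $\lambda C\subseteq C$ for all $\lambda>0$; it is GG-convex if $x^\lambda y^{1-\lambda}\in C$ for all $x,y\in C$, $\lambda\in(0,1)$ (powers and products pointwise, and componentwise for vectors). A $(0,\infty)$-valued map $f$ on a GG-convex set is GG-convex if $f(x^\lambda y^{1-\lambda})\le f(x)^\lambda f(y)^{1-\lambda}$ for all $x,y$, $\lambda\in(0,1)$; positively homogeneous if $f(\lambda x)=\lambda f(x)$ for $\lambda>0$; increasing if $x\le y$ (a.s., componentwise) implies $f(x)\le f(y)$. For a function $g$ on $(0,\infty)^n$ and $\mathbf{X}\in E^n$, $g(\mathbf{X})$ is $\omega\mapsto g(\mathbf{X}(\omega))$; $g(E^n)=\{g(\mathbf{X}):\mathbf{X}\in E^n\}$; $(\tilde\rho_0\circ\tilde\Lambda)(\mathbf{X})=\tilde\rho_0(\tilde\Lambda(\mathbf{X}))$. Vectors in $(0,\infty)^n$ are identified with constant elements of $E^n$. An increasing map $\tilde\rho:E^n\to(0,\infty)$ is a systemic return risk measure if: (1) $\tilde\rho((0,\infty)^n)=I$; (2) $\tilde\rho|_{(0,\infty)^n}(E^n)=E_I$ (random variables $\omega\mapsto\tilde\rho(\mathbf{X}(\omega))$); (3) (preference consistency) for $\mathbf{X},\mathbf{Y}\in E^n$, $\tilde\rho(\mathbf{X}(\omega))\le\tilde\rho(\mathbf{Y}(\omega))$ for a.e. $\omega$ implies $\tilde\rho(\mathbf{X})\le\tilde\rho(\mathbf{Y})$.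 It is a GG-convex systemic return risk measure if in addition it is GG-convex and satisfies: (4) (risk GG-convexity) for $\mathbf{X},\mathbf{Y},\mathbf{Z}\in E^n$, $\lambda\in(0,1)$ with $\tilde\rho(\mathbf{Z}(\omega))=\tilde\rho(\mathbf{X}(\omega))^\lambda\tilde\rho(\mathbf{Y}(\omega))^{1-\lambda}$ for a.e. $\omega$, one has $\tilde\rho(\mathbf{Z})\le\tilde\rho(\mathbf{X})^\lambda\tilde\rho(\mathbf{Y})^{1-\lambda}$. It is GG-coherent if it is moreover positively homogeneous. A return aggregation function is an increasing surjective map $\tilde\Lambda:(0,\infty)^n\to I$ with $\tilde\Lambda(E^n)=E_I$; it is a GG-convex return aggregation function if it is also GG-convex, and a GG-coherent one if it is GG-convex and positively homogeneous. *)

theory Defs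
  imports "HOL-Probability.Probability"
begin

text \<open>
  Random variables are represented by functions, and everything is invariant under almost sure
  equality: a set of classes in \<open>L\<^sup>\<infinity>\<close> is a set of measurable functions that is closed under
  almost sure equality (\<open>ae_closed\<close>), and a map on classes is a map on representatives that
  respects almost sure equality (\<open>pos_functional\<close>).  An element of \<open>E\<^sup>n\<close> is a random vector
  of type \<open>'a \<Rightarrow> real ^ 'n\<close> all of whose components are in \<open>E\<close>; the vector \<open>v\<close>,
  regarded as a constant element of \<open>E\<^sup>n\<close>, is \<open>\<lambda>_. v\<close>.  The order on \<open>real ^ 'n\<close>
  is the componentwise one.
\<close>

definition Linf_pp :: "'a measure \<Rightarrow> ('a \<Rightarrow> real) set" where
  "Linf_pp M = {X \<in> borel_measurable M.
     (\<exists>c. AE \<omega> in M. \<bar>X \<omega>\<bar> \<le> c) \<and> (AE \<omega> in M. 0 < X \<omega>)}"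

definition ae_closed :: "'a measure \<Rightarrow> ('a \<Rightarrow> real) set \<Rightarrow> bool" where
  "ae_closed M C \<longleftrightarrow>
     (\<forall>X\<in>C. \<forall>Y\<in>borel_measurable M. (AE \<omega> in M. X \<omega> = Y \<omega>) \<longrightarrow> Y \<in> C)"

definition pos_orthant :: "(real ^ 'n) set" where
  "pos_orthant = {x. \<forall>i. 0 < x $ i}"

definition rv_power :: "('a \<Rightarrow> real) set \<Rightarrow> ('a \<Rightarrow> real ^ 'n) set" where
  "rv_power E = {X. \<forall>i. (\<lambda>\<omega>. X \<omega> $ i) \<in> E}"

definition rv_in :: "'a measure \<Rightarrow> ('a \<Rightarrow> real) set \<Rightarrow> real set \<Rightarrow> ('a \<Rightarrow> real) set" where
  "rv_in M E I = {X \<in> E. AE \<omega> in M. X \<omega> \<in> I}"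

definition gg_mix :: "real \<Rightarrow> real \<Rightarrow> real \<Rightarrow> real" where
  "gg_mix l x y = x powr l * y powr (1 - l)"

definition gg_mix_vec :: "real \<Rightarrow> real ^ 'n \<Rightarrow> real ^ 'n \<Rightarrow> real ^ 'n" where
  "gg_mix_vec l x y = (\<chi> i. gg_mix l (x $ i) (y $ i))"

definition rv_mix ::
  "(real \<Rightarrow> 'b \<Rightarrow> 'b \<Rightarrow> 'b) \<Rightarrow> real \<Rightarrow> ('a \<Rightarrow> 'b) \<Rightarrow> ('a \<Rightarrow> 'b) \<Rightarrow> ('a \<Rightarrow> 'b)" where
  "rv_mix mix l X Y = (\<lambda>\<omega>. mix l (X \<omega>) (Y \<omega>))"

definition rv_scale :: "real \<Rightarrow> ('a \<Rightarrow> 'b::real_vector) \<Rightarrow> ('a \<Rightarrow> 'b)" where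
  "rv_scale c X = (\<lambda>\<omega>. c *\<^sub>R X \<omega>)"

definition gg_convex_cone :: "('a \<Rightarrow> real) set \<Rightarrow> bool" where
  "gg_convex_cone C \<longleftrightarrow>
     (\<forall>X\<in>C. \<forall>c>0. rv_scale c X \<in> C) \<and>
     (\<forall>X\<in>C. \<forall>Y\<in>C. \<forall>l\<in>{0<..<1}. rv_mix gg_mix l X Y \<in> C)"

text \<open>
  The geometric mean \<open>mix\<close> and the scaling \<open>scl\<close> of the domain are parameters, since the
  domain may consist of vectors, random variables or random vectors.
\<close>

definition gg_convex_on :: "(real \<Rightarrow> 'd \<Rightarrow> 'd \<Rightarrow> 'd) \<Rightarrow> 'd set \<Rightarrow> ('d \<Rightarrow> real) \<Rightarrow> bool" where
  "gg_convex_on mix D f \<longleftrightarrow>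
     (\<forall>x\<in>D. \<forall>y\<in>D. \<forall>l\<in>{0<..<1}. f (mix l x y) \<le> f x powr l * f y powr (1 - l))"

definition pos_homogeneous_on :: "(real \<Rightarrow> 'd \<Rightarrow> 'd) \<Rightarrow> 'd set \<Rightarrow> ('d \<Rightarrow> real) \<Rightarrow> bool" where
  "pos_homogeneous_on scl D f \<longleftrightarrow> (\<forall>x\<in>D. \<forall>c>0. f (scl c x) = c * f x)"

definition ae_increasing_on ::
  "'a measure \<Rightarrow> ('a \<Rightarrow> 'b::ord) set \<Rightarrow> (('a \<Rightarrow> 'b) \<Rightarrow> real) \<Rightarrow> bool" where
  "ae_increasing_on M D f \<longleftrightarrow>
     (\<forall>X\<in>D. \<forall>Y\<in>D. (AE \<omega> in M. X \<omega> \<le> Y \<omega>) \<longrightarrow> f X \<le> f Y)"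

definition pos_functional ::
  "'a measure \<Rightarrow> ('a \<Rightarrow> 'b) set \<Rightarrow> (('a \<Rightarrow> 'b) \<Rightarrow> real) \<Rightarrow> bool" where
  "pos_functional M D f \<longleftrightarrow>
     (\<forall>X\<in>D. 0 < f X) \<and>
     (\<forall>X\<in>D. \<forall>Y\<in>D. (AE \<omega> in M. X \<omega> = Y \<omega>) \<longrightarrow> f X = f Y)"

text \<open>
  \<open>g(E\<^sup>n) = F\<close> as an equality of sets of classes.  The function \<open>g\<close> need not be Borel, so
  measurability of \<open>\<lambda>\<omega>. g (X \<omega>)\<close> may depend on the representative of \<open>X\<close>; that \<open>g(X)\<close> is in
  \<open>F\<close> therefore means that it is almost surely equal to some member of \<open>F\<close>.
\<close>

definition rv_image_eq ::
  "'a measure \<Rightarrow> ('a \<Rightarrow> real) set \<Rightarrow> (real ^ 'n \<Rightarrow> real) \<Rightarrow> ('a \<Rightarrow> real) set \<Rightarrow> bool" where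
  "rv_image_eq M E g F \<longleftrightarrow>
     (\<forall>X\<in>rv_power E. \<exists>Z\<in>F. AE \<omega> in M. Z \<omega> = g (X \<omega>)) \<and>
     (\<forall>Z\<in>F. \<exists>X\<in>rv_power E. AE \<omega> in M. Z \<omega> = g (X \<omega>))"

text \<open>\<open>\<rho> = \<rho>0 \<circ> \<Lambda>\<close> on \<open>E\<^sup>n\<close>, where \<open>Z\<close> is a representative in \<open>F\<close> of \<open>\<Lambda>(X)\<close>.\<close>

definition is_composition ::
  "'a measure \<Rightarrow> ('a \<Rightarrow> real) set \<Rightarrow> ('a \<Rightarrow> real) set \<Rightarrow> (('a \<Rightarrow> real ^ 'n) \<Rightarrow> real) \<Rightarrow>
   (('a \<Rightarrow> real) \<Rightarrow> real) \<Rightarrow> (real ^ 'n \<Rightarrow> real) \<Rightarrow> bool" where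
  "is_composition M E F \<rho> \<rho>0 \<Lambda> \<longleftrightarrow>
     (\<forall>X\<in>rv_power E. \<exists>Z\<in>F. (AE \<omega> in M. Z \<omega> = \<Lambda> (X \<omega>)) \<and> \<rho> X = \<rho>0 Z)"

definition systemic_rrm ::
  "'a measure \<Rightarrow> ('a \<Rightarrow> real) set \<Rightarrow> real set \<Rightarrow> (('a \<Rightarrow> real ^ 'n) \<Rightarrow> real) \<Rightarrow> bool" where
  "systemic_rrm M E I \<rho> \<longleftrightarrow>
     pos_functional M (rv_power E) \<rho> \<and>
     ae_increasing_on M (rv_power E) \<rho> \<and>
     (\<lambda>x. \<rho> (\<lambda>_. x)) ` pos_orthant = I \<and>
     rv_image_eq M E (\<lambda>x. \<rho> (\<lambda>_. x)) (rv_in M E I) \<and>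
     (\<forall>X\<in>rv_power E. \<forall>Y\<in>rv_power E.
        (AE \<omega> in M. \<rho> (\<lambda>_. X \<omega>) \<le> \<rho> (\<lambda>_. Y \<omega>)) \<longrightarrow> \<rho> X \<le> \<rho> Y)"

definition risk_gg_convex ::
  "'a measure \<Rightarrow> ('a \<Rightarrow> real) set \<Rightarrow> (('a \<Rightarrow> real ^ 'n) \<Rightarrow> real) \<Rightarrow> bool" where
  "risk_gg_convex M E \<rho> \<longleftrightarrow>
     (\<forall>X\<in>rv_power E. \<forall>Y\<in>rv_power E. \<forall>Z\<in>rv_power E. \<forall>l\<in>{0<..<1}.
        (AE \<omega> in M. \<rho> (\<lambda>_. Z \<omega>) = \<rho> (\<lambda>_. X \<omega>) powr l * \<rho> (\<lambda>_. Y \<omega>) powr (1 - l)) \<longrightarrow>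
        \<rho> Z \<le> \<rho> X powr l * \<rho> Y powr (1 - l))"

definition gg_convex_systemic_rrm ::
  "'a measure \<Rightarrow> ('a \<Rightarrow> real) set \<Rightarrow> real set \<Rightarrow> (('a \<Rightarrow> real ^ 'n) \<Rightarrow> real) \<Rightarrow> bool" where
  "gg_convex_systemic_rrm M E I \<rho> \<longleftrightarrow>
     systemic_rrm M E I \<rho> \<and>
     gg_convex_on (rv_mix gg_mix_vec) (rv_power E) \<rho> \<and>
     risk_gg_convex M E \<rho>"

definition gg_coherent_systemic_rrm ::
  "'a measure \<Rightarrow> ('a \<Rightarrow> real) set \<Rightarrow> real set \<Rightarrow> (('a \<Rightarrow> real ^ 'n) \<Rightarrow> real) \<Rightarrow> bool" where
  "gg_coherent_systemic_rrm M E I \<rho> \<longleftrightarrow>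
     gg_convex_systemic_rrm M E I \<rho> \<and> pos_homogeneous_on rv_scale (rv_power E) \<rho>"

definition return_aggregation ::
  "'a measure \<Rightarrow> ('a \<Rightarrow> real) set \<Rightarrow> real set \<Rightarrow> (real ^ 'n \<Rightarrow> real) \<Rightarrow> bool" where
  "return_aggregation M E I \<Lambda> \<longleftrightarrow>
     mono_on pos_orthant \<Lambda> \<and> \<Lambda> ` pos_orthant = I \<and> rv_image_eq M E \<Lambda> (rv_in M E I)"

definition gg_convex_return_aggregation ::
  "'a measure \<Rightarrow> ('a \<Rightarrow> real) set \<Rightarrow> real set \<Rightarrow> (real ^ 'n \<Rightarrow> real) \<Rightarrow> bool" where
  "gg_convex_return_aggregation M E I \<Lambda> \<longleftrightarrow>
     return_aggregation M E I \<Lambda> \<and> gg_convex_on gg_mix_vec pos_orthant \<Lambda>"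

definition gg_coherent_return_aggregation ::
  "'a measure \<Rightarrow> ('a \<Rightarrow> real) set \<Rightarrow> real set \<Rightarrow> (real ^ 'n \<Rightarrow> real) \<Rightarrow> bool" where
  "gg_coherent_return_aggregation M E I \<Lambda> \<longleftrightarrow>
     gg_convex_return_aggregation M E I \<Lambda> \<and> pos_homogeneous_on (*\<^sub>R) pos_orthant \<Lambda>"

definition constancy_on :: "real set \<Rightarrow> (('a \<Rightarrow> real) \<Rightarrow> real) \<Rightarrow> bool" where
  "constancy_on I f \<longleftrightarrow> (\<forall>x\<in>I. f (\<lambda>_. x) = x)"

end

theory Submission
  imports Defs
begin

text \<open>
  On constants \<open>\<rho>\<close> must agree with \<open>\<Lambda>\<close>, by the constancy property, so \<open>\<Lambda>\<close> is the restriction of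
  \<open>\<rho>\<close> to constant vectors. Since \<open>\<Lambda>(E\<^sup>n) = E\<^sub>I\<close>, every \<open>Z\<close> in \<open>E\<^sub>I\<close> is \<open>\<Lambda>(X)\<close> for some \<open>X\<close>, and
  \<open>\<rho>0 Z = \<rho> X\<close> is forced; preference consistency says exactly that this is well defined and
  increasing. Along this correspondence risk GG-convexity of \<open>\<rho>\<close> becomes GG-convexity of \<open>\<rho>0\<close>, and
  GG-convexity and positive homogeneity of \<open>\<rho>\<close> on constants become those of \<open>\<Lambda>\<close>.
\<close>

section \<open>Closure properties of the spaces of random variables and of the orthant\<close>

locale gg_domain =
  fixes M :: "'a measure" and E :: "('a \<Rightarrow> real) set" and I :: "real set"
  assumes E_subset: "E \<subseteq> Linf_pp M"
    and E_cone: "gg_convex_cone E"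
    and E_const: "\<And>c. c > 0 \<Longrightarrow> (\<lambda>_. c) \<in> E"
    and I_subset: "I \<subseteq> {0<..}"
    and rv_in_cone: "gg_convex_cone (rv_in M E I)"
begin

lemma const_in_rv_in: "x \<in> I \<Longrightarrow> (\<lambda>_. x) \<in> rv_in M E I"
  using E_const I_subset by (auto simp: rv_in_def)

lemma const_in_rv_power: "v \<in> pos_orthant \<Longrightarrow> (\<lambda>_. v) \<in> rv_power E"
  using E_const by (auto simp: rv_power_def pos_orthant_def)

text \<open>Finitely many null sets are united. The lemma matters because \<open>\<Lambda>\<close>
  is controlled only on the orthant, which a representative of a vector in \<open>E\<^sup>n\<close>
  may leave on a null set.\<close>

lemma AE_pos_orthant:
  fixes X :: "'a \<Rightarrow> real ^ 'n::finite"
  assumes "X \<in> rv_power E"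
  shows "AE \<omega> in M. X \<omega> \<in> pos_orthant"
proof -
  have "AE \<omega> in M. 0 < X \<omega> $ i" for i
    using assms E_subset by (auto simp: rv_power_def Linf_pp_def)
  then show ?thesis
    by (simp add: pos_orthant_def AE_all_countable)
qed

lemma rv_scale_rv_in: "Z \<in> rv_in M E I \<Longrightarrow> c > 0 \<Longrightarrow> rv_scale c Z \<in> rv_in M E I"
  using rv_in_cone by (auto simp: gg_convex_cone_def)

lemma rv_mix_rv_in:
  "Z \<in> rv_in M E I \<Longrightarrow> W \<in> rv_in M E I \<Longrightarrow> l \<in> {0<..<1} \<Longrightarrow> rv_mix gg_mix l Z W \<in> rv_in M E I"
  using rv_in_cone by (auto simp: gg_convex_cone_def)

lemma rv_scale_rv_power: "X \<in> rv_power E \<Longrightarrow> c > 0 \<Longrightarrow> rv_scale c X \<in> rv_power E"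
  using E_cone by (auto simp: gg_convex_cone_def rv_power_def rv_scale_def)

lemma rv_mix_rv_power:
  "X \<in> rv_power E \<Longrightarrow> Y \<in> rv_power E \<Longrightarrow> l \<in> {0<..<1} \<Longrightarrow> rv_mix gg_mix_vec l X Y \<in> rv_power E"
  using E_cone by (auto simp: gg_convex_cone_def rv_power_def rv_mix_def gg_mix_vec_def)

end

lemma gg_mix_vec_pos_orthant:
  "x \<in> pos_orthant \<Longrightarrow> y \<in> pos_orthant \<Longrightarrow> gg_mix_vec l x y \<in> pos_orthant"
  by (simp add: pos_orthant_def gg_mix_vec_def gg_mix_def)
    (metis less_irrefl mult_pos_pos powr_gt_zero)

lemma scaleR_pos_orthant: "x \<in> pos_orthant \<Longrightarrow> c > 0 \<Longrightarrow> c *\<^sub>R x \<in> pos_orthant"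
  by (simp add: pos_orthant_def)

text \<open>Captures the correspondence between \<open>X\<close> and \<open>Z = \<Lambda>(X)\<close>
  for both directions of the theorem. \<open>rho_eq\<close> quantifies over every representative
  \<open>Z\<close>, whereas \<open>is_composition\<close> provides just one; a \<open>Z\<close>
  built by hand, such as a geometric mean or a multiple, can then be used at once.\<close>

locale rrm_factorization = gg_domain M E I
  for M :: "'a measure" and E :: "('a \<Rightarrow> real) set" and I :: "real set" +
  fixes \<rho> :: "('a \<Rightarrow> real ^ 'n::finite) \<Rightarrow> real"
    and \<rho>0 :: "('a \<Rightarrow> real) \<Rightarrow> real" and \<Lambda> :: "real ^ 'n \<Rightarrow> real"
  assumes rho_const: "\<And>v. v \<in> pos_orthant \<Longrightarrow> \<rho> (\<lambda>_. v) = \<Lambda> v"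
    and rho_eq: "\<And>X Z. X \<in> rv_power E \<Longrightarrow> Z \<in> rv_in M E I \<Longrightarrow>
      (AE \<omega> in M. Z \<omega> = \<Lambda> (X \<omega>)) \<Longrightarrow> \<rho> X = \<rho>0 Z"
    and image_eq: "rv_image_eq M E \<Lambda> (rv_in M E I)"
begin

section \<open>Transfer of properties along a factorization\<close>

lemma AE_rho_const: "X \<in> rv_power E \<Longrightarrow> AE \<omega> in M. \<rho> (\<lambda>_. X \<omega>) = \<Lambda> (X \<omega>)"
  using AE_pos_orthant by (rule AE_mp) (auto simp: rho_const)

text \<open>One inclusion of \<open>\<Lambda>(E\<^sup>n) = E\<^sub>I\<close>;
  \<open>rv_in_cases\<close> is the other. Together they move any statement between
  \<open>\<rho>\<close> and \<open>\<rho>0\<close>.\<close>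

lemma rv_power_cases:
  assumes "X \<in> rv_power E"
  obtains Z where "Z \<in> rv_in M E I" "AE \<omega> in M. Z \<omega> = \<Lambda> (X \<omega>)" "\<rho> X = \<rho>0 Z"
  using assms image_eq rho_eq unfolding rv_image_eq_def by metis

lemma rv_in_cases:
  assumes "Z \<in> rv_in M E I"
  obtains X where "X \<in> rv_power E" "AE \<omega> in M. Z \<omega> = \<Lambda> (X \<omega>)" "\<rho> X = \<rho>0 Z"
  using assms image_eq rho_eq unfolding rv_image_eq_def by metis

lemma rv_image_eq_rho_const: "rv_image_eq M E (\<lambda>x. \<rho> (\<lambda>_. x)) (rv_in M E I)"
  unfolding rv_image_eq_def
proof (intro conjI ballI)
  fix X :: "'a \<Rightarrow> real ^ 'n" assume X: "X \<in> rv_power E"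
  then obtain Z where "Z \<in> rv_in M E I" "AE \<omega> in M. Z \<omega> = \<Lambda> (X \<omega>)"
    by (rule rv_power_cases)
  moreover from this(2) AE_rho_const[OF X] have "AE \<omega> in M. Z \<omega> = \<rho> (\<lambda>_. X \<omega>)"
    by eventually_elim simp
  ultimately show "\<exists>Z\<in>rv_in M E I. AE \<omega> in M. Z \<omega> = \<rho> (\<lambda>_. X \<omega>)" by blast
next
  fix Z assume "Z \<in> rv_in M E I"
  then obtain X where "X \<in> rv_power E" "AE \<omega> in M. Z \<omega> = \<Lambda> (X \<omega>)"
    by (rule rv_in_cases)
  moreover from this(2) AE_rho_const[OF this(1)] have "AE \<omega> in M. Z \<omega> = \<rho> (\<lambda>_. X \<omega>)"
    by eventually_elim simp
  ultimately show "\<exists>X\<in>rv_power E. AE \<omega> in M. Z \<omega> = \<rho> (\<lambda>_. X \<omega>)" by blast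
qed

text \<open>The geometric mean of constant vectors is constant, so the inequality for \<rho> is
  tested on constants.\<close>

lemma gg_convex_aggregation:
  assumes "gg_convex_on (rv_mix gg_mix_vec) (rv_power E) \<rho>"
  shows "gg_convex_on gg_mix_vec pos_orthant \<Lambda>"
  unfolding gg_convex_on_def
proof (intro ballI)
  fix x y :: "real ^ 'n" and l :: real
  assume xy: "x \<in> pos_orthant" "y \<in> pos_orthant" and l: "l \<in> {0<..<1}"
  have "\<rho> (rv_mix gg_mix_vec l (\<lambda>_. x) (\<lambda>_. y)) \<le> \<rho> (\<lambda>_. x) powr l * \<rho> (\<lambda>_. y) powr (1 - l)"
    using assms xy l const_in_rv_power unfolding gg_convex_on_def by blast
  then show "\<Lambda> (gg_mix_vec l x y) \<le> \<Lambda> x powr l * \<Lambda> y powr (1 - l)"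
    using xy by (simp add: rv_mix_def rho_const gg_mix_vec_pos_orthant)
qed

text \<open>The premise of risk GG-convexity says that \<Lambda>(V) is the geometric mean of
  \<Lambda>(X) and \<Lambda>(Y). Since \<open>E\<^sub>I\<close> is closed under such means, these
  triples correspond to the pairs \<open>Z\<close>, \<open>W\<close> together with their
  mean.\<close>

lemma risk_gg_convex_iff:
  "risk_gg_convex M E \<rho> \<longleftrightarrow> gg_convex_on (rv_mix gg_mix) (rv_in M E I) \<rho>0"
proof
  assume risk: "risk_gg_convex M E \<rho>"
  show "gg_convex_on (rv_mix gg_mix) (rv_in M E I) \<rho>0"
    unfolding gg_convex_on_def
  proof (intro ballI)
    fix Z W and l :: real
    assume Z: "Z \<in> rv_in M E I" and W: "W \<in> rv_in M E I" and l: "l \<in> {0<..<1}"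
    obtain X where X: "X \<in> rv_power E" "AE \<omega> in M. Z \<omega> = \<Lambda> (X \<omega>)" "\<rho> X = \<rho>0 Z"
      using Z by (rule rv_in_cases)
    obtain Y where Y: "Y \<in> rv_power E" "AE \<omega> in M. W \<omega> = \<Lambda> (Y \<omega>)" "\<rho> Y = \<rho>0 W"
      using W by (rule rv_in_cases)
    \<comment> \<open>\<open>V\<close> is a preimage of the mean of \<open>Z\<close> and
      \<open>W\<close>, not the mean of \<open>X\<close> and \<open>Y\<close>: risk GG-convexity
      requires an equality of aggregated values.\<close>
    obtain V where V: "V \<in> rv_power E" "AE \<omega> in M. rv_mix gg_mix l Z W \<omega> = \<Lambda> (V \<omega>)"
        "\<rho> V = \<rho>0 (rv_mix gg_mix l Z W)"
      using rv_mix_rv_in[OF Z W l] by (rule rv_in_cases)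
    have "AE \<omega> in M. \<rho> (\<lambda>_. V \<omega>) = \<rho> (\<lambda>_. X \<omega>) powr l * \<rho> (\<lambda>_. Y \<omega>) powr (1 - l)"
      using X(2) Y(2) V(2) X(1)[THEN AE_rho_const] Y(1)[THEN AE_rho_const] V(1)[THEN AE_rho_const]
      by eventually_elim (simp add: rv_mix_def gg_mix_def)
    then show "\<rho>0 (rv_mix gg_mix l Z W) \<le> \<rho>0 Z powr l * \<rho>0 W powr (1 - l)"
      using risk X(1) Y(1) V(1) l
      unfolding risk_gg_convex_def X(3)[symmetric] Y(3)[symmetric] V(3)[symmetric] by blast
  qed
next
  assume conv: "gg_convex_on (rv_mix gg_mix) (rv_in M E I) \<rho>0"
  show "risk_gg_convex M E \<rho>"
    unfolding risk_gg_convex_def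
  proof (intro ballI impI)
    fix X Y V :: "'a \<Rightarrow> real ^ 'n" and l :: real
    assume X: "X \<in> rv_power E" and Y: "Y \<in> rv_power E" and V: "V \<in> rv_power E"
      and l: "l \<in> {0<..<1}"
      and mix: "AE \<omega> in M. \<rho> (\<lambda>_. V \<omega>) = \<rho> (\<lambda>_. X \<omega>) powr l * \<rho> (\<lambda>_. Y \<omega>) powr (1 - l)"
    obtain Z where Z: "Z \<in> rv_in M E I" "AE \<omega> in M. Z \<omega> = \<Lambda> (X \<omega>)" "\<rho> X = \<rho>0 Z"
      using X by (rule rv_power_cases)
    obtain W where W: "W \<in> rv_in M E I" "AE \<omega> in M. W \<omega> = \<Lambda> (Y \<omega>)" "\<rho> Y = \<rho>0 W"
      using Y by (rule rv_power_cases)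
    have "AE \<omega> in M. rv_mix gg_mix l Z W \<omega> = \<Lambda> (V \<omega>)"
      using Z(2) W(2) mix X[THEN AE_rho_const] Y[THEN AE_rho_const] V[THEN AE_rho_const]
      by eventually_elim (simp add: rv_mix_def gg_mix_def)
    then have "\<rho> V = \<rho>0 (rv_mix gg_mix l Z W)"
      by (intro rho_eq V rv_mix_rv_in Z W l)
    then show "\<rho> V \<le> \<rho> X powr l * \<rho> Y powr (1 - l)"
      using conv Z(1) W(1) l unfolding gg_convex_on_def Z(3) W(3) by simp
  qed
qed

text \<open>GG-convexity of \<Lambda> bounds the aggregate of the mean by the mean of the aggregates
  almost surely; monotonicity of \<open>\<rho>0\<close> preserves this bound, and GG-convexity of
  \<open>\<rho>0\<close> finishes.\<close>

lemma gg_convex_composition: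
  assumes incr: "ae_increasing_on M (rv_in M E I) \<rho>0"
    and conv: "gg_convex_on gg_mix_vec pos_orthant \<Lambda>"
    and conv0: "gg_convex_on (rv_mix gg_mix) (rv_in M E I) \<rho>0"
  shows "gg_convex_on (rv_mix gg_mix_vec) (rv_power E) \<rho>"
  unfolding gg_convex_on_def
proof (intro ballI)
  fix X Y :: "'a \<Rightarrow> real ^ 'n" and l :: real
  assume X: "X \<in> rv_power E" and Y: "Y \<in> rv_power E" and l: "l \<in> {0<..<1}"
  obtain Z where Z: "Z \<in> rv_in M E I" "AE \<omega> in M. Z \<omega> = \<Lambda> (X \<omega>)" "\<rho> X = \<rho>0 Z"
    using X by (rule rv_power_cases)
  obtain W where W: "W \<in> rv_in M E I" "AE \<omega> in M. W \<omega> = \<Lambda> (Y \<omega>)" "\<rho> Y = \<rho>0 W"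
    using Y by (rule rv_power_cases)
  obtain V where V: "V \<in> rv_in M E I" "AE \<omega> in M. V \<omega> = \<Lambda> (rv_mix gg_mix_vec l X Y \<omega>)"
      "\<rho> (rv_mix gg_mix_vec l X Y) = \<rho>0 V"
    using rv_mix_rv_power[OF X Y l] by (rule rv_power_cases)
  have "AE \<omega> in M. V \<omega> \<le> rv_mix gg_mix l Z W \<omega>"
    using Z(2) W(2) V(2) AE_pos_orthant[OF X] AE_pos_orthant[OF Y]
    by eventually_elim (use conv l in \<open>auto simp: rv_mix_def gg_mix_def gg_convex_on_def\<close>)
  then have "\<rho>0 V \<le> \<rho>0 (rv_mix gg_mix l Z W)"
    using incr V(1) rv_mix_rv_in[OF Z(1) W(1) l] unfolding ae_increasing_on_def by blast
  also have "\<dots> \<le> \<rho>0 Z powr l * \<rho>0 W powr (1 - l)"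
    using conv0 Z(1) W(1) l unfolding gg_convex_on_def by blast
  finally show "\<rho> (rv_mix gg_mix_vec l X Y) \<le> \<rho> X powr l * \<rho> Y powr (1 - l)"
    by (simp add: Z(3) W(3) V(3))
qed

lemma pos_homogeneous_aggregation:
  assumes "pos_homogeneous_on rv_scale (rv_power E) \<rho>"
  shows "pos_homogeneous_on (*\<^sub>R) pos_orthant \<Lambda>"
  unfolding pos_homogeneous_on_def
proof (intro ballI allI impI)
  fix x :: "real ^ 'n" and c :: real
  assume x: "x \<in> pos_orthant" and c: "c > 0"
  have "\<rho> (rv_scale c (\<lambda>_. x)) = c * \<rho> (\<lambda>_. x)"
    using assms x c const_in_rv_power unfolding pos_homogeneous_on_def by blast
  then show "\<Lambda> (c *\<^sub>R x) = c * \<Lambda> x"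
    using x c by (simp add: rv_scale_def rho_const scaleR_pos_orthant)
qed

text \<open>Homogeneity of \<Lambda> on the orthant makes \<open>c Z\<close> a representative of
  \<Lambda>(c X), so scaling respects the correspondence.\<close>

lemma rho_scale:
  assumes hom: "pos_homogeneous_on (*\<^sub>R) pos_orthant \<Lambda>"
    and X: "X \<in> rv_power E" and Z: "Z \<in> rv_in M E I" "AE \<omega> in M. Z \<omega> = \<Lambda> (X \<omega>)"
    and c: "c > 0"
  shows "\<rho> (rv_scale c X) = \<rho>0 (rv_scale c Z)"
proof (intro rho_eq rv_scale_rv_power rv_scale_rv_in X Z c)
  show "AE \<omega> in M. rv_scale c Z \<omega> = \<Lambda> (rv_scale c X \<omega>)"
    using Z(2) AE_pos_orthant[OF X]
    by eventually_elim (use hom c in \<open>auto simp: rv_scale_def pos_homogeneous_on_def\<close>)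
qed

text \<open>From left to right the order matters: homogeneity of \<Lambda> comes first, from
  constants, and only then does \<open>rho_scale\<close> pass homogeneity on to
  \<open>\<rho>0\<close>.\<close>

lemma pos_homogeneous_iff:
  "pos_homogeneous_on rv_scale (rv_power E) \<rho> \<longleftrightarrow>
     pos_homogeneous_on (*\<^sub>R) pos_orthant \<Lambda> \<and> pos_homogeneous_on rv_scale (rv_in M E I) \<rho>0"
proof (intro iffI conjI)
  assume hom: "pos_homogeneous_on rv_scale (rv_power E) \<rho>"
  then show hom': "pos_homogeneous_on (*\<^sub>R) pos_orthant \<Lambda>"
    by (rule pos_homogeneous_aggregation)
  show "pos_homogeneous_on rv_scale (rv_in M E I) \<rho>0"
    unfolding pos_homogeneous_on_def
  proof (intro ballI allI impI)
    fix Z and c :: real assume Z: "Z \<in> rv_in M E I" and c: "c > 0"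
    obtain X where X: "X \<in> rv_power E" "AE \<omega> in M. Z \<omega> = \<Lambda> (X \<omega>)" "\<rho> X = \<rho>0 Z"
      using Z by (rule rv_in_cases)
    show "\<rho>0 (rv_scale c Z) = c * \<rho>0 Z"
      using hom X(1) c rho_scale[OF hom' X(1) Z X(2) c]
      unfolding pos_homogeneous_on_def X(3)[symmetric] by simp
  qed
next
  assume hom: "pos_homogeneous_on (*\<^sub>R) pos_orthant \<Lambda> \<and>
    pos_homogeneous_on rv_scale (rv_in M E I) \<rho>0"
  show "pos_homogeneous_on rv_scale (rv_power E) \<rho>"
    unfolding pos_homogeneous_on_def
  proof (intro ballI allI impI)
    fix X :: "'a \<Rightarrow> real ^ 'n" and c :: real assume X: "X \<in> rv_power E" and c: "c > 0"
    obtain Z where Z: "Z \<in> rv_in M E I" "AE \<omega> in M. Z \<omega> = \<Lambda> (X \<omega>)" "\<rho> X = \<rho>0 Z"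
      using X by (rule rv_power_cases)
    show "\<rho> (rv_scale c X) = c * \<rho> X"
      using hom Z(1) c rho_scale[OF _ X Z(1,2) c] unfolding pos_homogeneous_on_def Z(3) by auto
  qed
qed

text \<open>Monotonicity and preference consistency both reduce to \<open>pref\<close>, which lifts
  an almost sure inequality of aggregates to \<rho> through the monotone
  \<open>\<rho>0\<close>.\<close>

lemma systemic_rrm_composition:
  assumes pos: "pos_functional M (rv_power E) \<rho>"
    and agg: "return_aggregation M E I \<Lambda>"
    and incr: "ae_increasing_on M (rv_in M E I) \<rho>0"
  shows "systemic_rrm M E I \<rho>"
proof -
  have pref: "\<rho> X \<le> \<rho> Y" if X: "X \<in> rv_power E" and Y: "Y \<in> rv_power E"
    and le: "AE \<omega> in M. \<Lambda> (X \<omega>) \<le> \<Lambda> (Y \<omega>)" for X Y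
  proof -
    obtain Z where Z: "Z \<in> rv_in M E I" "AE \<omega> in M. Z \<omega> = \<Lambda> (X \<omega>)" "\<rho> X = \<rho>0 Z"
      using X by (rule rv_power_cases)
    obtain W where W: "W \<in> rv_in M E I" "AE \<omega> in M. W \<omega> = \<Lambda> (Y \<omega>)" "\<rho> Y = \<rho>0 W"
      using Y by (rule rv_power_cases)
    have "AE \<omega> in M. Z \<omega> \<le> W \<omega>"
      using Z(2) W(2) le by eventually_elim simp
    then show ?thesis
      using incr Z(1) W(1) unfolding ae_increasing_on_def Z(3) W(3) by blast
  qed
  have "ae_increasing_on M (rv_power E) \<rho>"
    unfolding ae_increasing_on_def
  proof (intro ballI impI pref)
    fix X Y :: "'a \<Rightarrow> real ^ 'n"
    assume X: "X \<in> rv_power E" and Y: "Y \<in> rv_power E" and le: "AE \<omega> in M. X \<omega> \<le> Y \<omega>"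
    show "AE \<omega> in M. \<Lambda> (X \<omega>) \<le> \<Lambda> (Y \<omega>)"
      using le AE_pos_orthant[OF X] AE_pos_orthant[OF Y]
      by eventually_elim (use agg in \<open>auto simp: return_aggregation_def mono_on_def\<close>)
  qed
  moreover have "(\<lambda>x. \<rho> (\<lambda>_. x)) ` pos_orthant = I"
    using agg by (auto simp: return_aggregation_def rho_const image_def)
  moreover have "\<forall>X\<in>rv_power E. \<forall>Y\<in>rv_power E.
      (AE \<omega> in M. \<rho> (\<lambda>_. X \<omega>) \<le> \<rho> (\<lambda>_. Y \<omega>)) \<longrightarrow> \<rho> X \<le> \<rho> Y"
  proof (intro ballI impI pref)
    fix X Y :: "'a \<Rightarrow> real ^ 'n"
    assume X: "X \<in> rv_power E" and Y: "Y \<in> rv_power E"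
      and le: "AE \<omega> in M. \<rho> (\<lambda>_. X \<omega>) \<le> \<rho> (\<lambda>_. Y \<omega>)"
    show "AE \<omega> in M. \<Lambda> (X \<omega>) \<le> \<Lambda> (Y \<omega>)"
      using le AE_rho_const[OF X] AE_rho_const[OF Y] by eventually_elim simp
  qed
  ultimately show ?thesis
    using pos rv_image_eq_rho_const by (simp add: systemic_rrm_def)
qed

end

section \<open>Recognising and constructing factorizations\<close>

context gg_domain
begin

text \<open>Invariance of \<open>\<rho>0\<close> under almost sure equality upgrades the single
  representative in \<open>is_composition\<close> to all of them; the constancy property then
  identifies \<rho> on constants with \<Lambda>.\<close>

lemma composition_rrm_factorization:
  fixes \<rho> :: "('a \<Rightarrow> real ^ 'n::finite) \<Rightarrow> real"
  assumes pos0: "pos_functional M (rv_in M E I) \<rho>0"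
    and comp: "is_composition M E (rv_in M E I) \<rho> \<rho>0 \<Lambda>"
    and agg: "return_aggregation M E I \<Lambda>"
    and const: "constancy_on I \<rho>0"
  shows "rrm_factorization M E I \<rho> \<rho>0 \<Lambda>"
proof -
  have eq: "\<rho> X = \<rho>0 Z"
    if X: "X \<in> rv_power E" and Z: "Z \<in> rv_in M E I" "AE \<omega> in M. Z \<omega> = \<Lambda> (X \<omega>)" for X Z
  proof -
    obtain W where W: "W \<in> rv_in M E I" "AE \<omega> in M. W \<omega> = \<Lambda> (X \<omega>)" "\<rho> X = \<rho>0 W"
      using comp X unfolding is_composition_def by blast
    have "AE \<omega> in M. W \<omega> = Z \<omega>"
      using Z(2) W(2) by eventually_elim simp
    then show ?thesis
      using pos0 Z(1) W(1) unfolding pos_functional_def W(3) by blast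
  qed
  show ?thesis
  proof
    fix v :: "real ^ 'n" assume v: "v \<in> pos_orthant"
    then have I: "\<Lambda> v \<in> I"
      using agg by (auto simp: return_aggregation_def)
    have "\<rho> (\<lambda>_. v) = \<rho>0 (\<lambda>_. \<Lambda> v)"
      by (rule eq[OF const_in_rv_power[OF v] const_in_rv_in[OF I]]) simp
    then show "\<rho> (\<lambda>_. v) = \<Lambda> v"
      using const I by (simp add: constancy_on_def)
  qed (use eq agg in \<open>auto simp: return_aggregation_def\<close>)
qed

lemma systemic_rrm_factorization:
  fixes \<rho> :: "('a \<Rightarrow> real ^ 'n::finite) \<Rightarrow> real"
  assumes rrm: "systemic_rrm M E I \<rho>"
  obtains \<rho>0 \<Lambda> where "rrm_factorization M E I \<rho> \<rho>0 \<Lambda>"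
    "pos_functional M (rv_in M E I) \<rho>0"
    "is_composition M E (rv_in M E I) \<rho> \<rho>0 \<Lambda>"
    "return_aggregation M E I \<Lambda>"
    "ae_increasing_on M (rv_in M E I) \<rho>0"
    "constancy_on I \<rho>0"
proof -
  define \<Lambda> where "\<Lambda> = (\<lambda>x. \<rho> (\<lambda>_. x))"
  have image: "rv_image_eq M E \<Lambda> (rv_in M E I)" and onto: "\<Lambda> ` pos_orthant = I"
    and pref: "\<And>X Y. X \<in> rv_power E \<Longrightarrow> Y \<in> rv_power E \<Longrightarrow>
      (AE \<omega> in M. \<Lambda> (X \<omega>) \<le> \<Lambda> (Y \<omega>)) \<Longrightarrow> \<rho> X \<le> \<rho> Y"
    and pos: "\<And>X. X \<in> rv_power E \<Longrightarrow> 0 < \<rho> X"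
    and incr: "ae_increasing_on M (rv_power E) \<rho>"
    using rrm unfolding systemic_rrm_def pos_functional_def \<Lambda>_def by blast+
  \<comment> \<open>\<open>S\<close> chooses a preimage under \<Lambda> for each member of
    \<open>E\<^sub>I\<close>; \<open>eq\<close> below shows that the choice does not affect
    \<open>\<rho>0\<close>.\<close>
  obtain S where S: "\<And>Z. Z \<in> rv_in M E I \<Longrightarrow> S Z \<in> rv_power E"
      "\<And>Z. Z \<in> rv_in M E I \<Longrightarrow> AE \<omega> in M. Z \<omega> = \<Lambda> (S Z \<omega>)"
    using image unfolding rv_image_eq_def by metis
  define \<rho>0 where "\<rho>0 = (\<lambda>Z. \<rho> (S Z))"
  have incr0: "\<rho>0 Z \<le> \<rho>0 W"
    if ZW: "Z \<in> rv_in M E I" "W \<in> rv_in M E I" and le: "AE \<omega> in M. Z \<omega> \<le> W \<omega>" for Z W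
    unfolding \<rho>0_def
  proof (intro pref S(1) ZW)
    show "AE \<omega> in M. \<Lambda> (S Z \<omega>) \<le> \<Lambda> (S W \<omega>)"
      using le S(2)[OF ZW(1)] S(2)[OF ZW(2)] by eventually_elim simp
  qed
  have eq: "\<rho> X = \<rho>0 Z"
    if X: "X \<in> rv_power E" and Z: "Z \<in> rv_in M E I" and XZ: "AE \<omega> in M. Z \<omega> = \<Lambda> (X \<omega>)" for X Z
  proof -
    \<comment> \<open>\<open>X\<close> and \<open>S Z\<close> have almost surely equal aggregates,
      so preference consistency applies in both directions.\<close>
    have "AE \<omega> in M. \<Lambda> (X \<omega>) \<le> \<Lambda> (S Z \<omega>)" "AE \<omega> in M. \<Lambda> (S Z \<omega>) \<le> \<Lambda> (X \<omega>)"
      using XZ S(2)[OF Z] by (eventually_elim, simp)+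
    then show ?thesis
      unfolding \<rho>0_def by (intro antisym pref X S(1) Z)
  qed
  have fact: "rrm_factorization M E I \<rho> \<rho>0 \<Lambda>"
    by unfold_locales (simp add: \<Lambda>_def, erule (2) eq, rule image)
  have "pos_functional M (rv_in M E I) \<rho>0"
    unfolding pos_functional_def
  proof (intro conjI ballI impI)
    fix Z assume "Z \<in> rv_in M E I"
    then show "0 < \<rho>0 Z" using pos S(1) by (simp add: \<rho>0_def)
  next
    fix Z W assume ZW: "Z \<in> rv_in M E I" "W \<in> rv_in M E I" and eq: "AE \<omega> in M. Z \<omega> = W \<omega>"
    \<comment> \<open>Invariance under almost sure equality is monotonicity used twice.\<close>
    from eq have "AE \<omega> in M. Z \<omega> \<le> W \<omega>" "AE \<omega> in M. W \<omega> \<le> Z \<omega>"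
      by (eventually_elim, simp)+
    then show "\<rho>0 Z = \<rho>0 W" by (intro antisym incr0 ZW)
  qed
  moreover have "is_composition M E (rv_in M E I) \<rho> \<rho>0 \<Lambda>"
    using image eq unfolding rv_image_eq_def is_composition_def by metis
  moreover have "mono_on pos_orthant \<Lambda>"
    using incr unfolding ae_increasing_on_def \<Lambda>_def
    by (intro mono_onI) (simp add: const_in_rv_power)
  then have "return_aggregation M E I \<Lambda>"
    using image onto by (simp add: return_aggregation_def)
  moreover have "ae_increasing_on M (rv_in M E I) \<rho>0"
    using incr0 by (auto simp: ae_increasing_on_def)
  moreover have "constancy_on I \<rho>0"
    unfolding constancy_on_def
  proof
    fix x assume x: "x \<in> I"
    then obtain v where v: "v \<in> pos_orthant" "x = \<Lambda> v" using onto by auto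
    \<comment> \<open>The constant \<open>x\<close> represents the aggregate of the constant vector
      \<open>v\<close>, and the value of \<rho> there is \<Lambda> v = x by the choice of
      \<Lambda>.\<close>
    have "\<rho> (\<lambda>_. v) = \<rho>0 (\<lambda>_. x)"
      by (rule eq[OF const_in_rv_power[OF v(1)] const_in_rv_in[OF x]]) (simp add: v(2))
    then show "\<rho>0 (\<lambda>_. x) = x" by (simp add: v(2) \<Lambda>_def)
  qed
  ultimately show thesis using that fact by blast
qed

end

section \<open>The three equivalences\<close>

theorem theorem4p5:
  fixes M :: "'a measure" and I :: "real set" and E :: "('a \<Rightarrow> real) set"
    and \<rho> :: "('a \<Rightarrow> real ^ 'n::finite) \<Rightarrow> real"
  assumes "prob_space M"
    and "is_interval I" and "I \<subseteq> {0<..}"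
    and "E \<subseteq> Linf_pp M" and "ae_closed M E"
    and "gg_convex_cone E"
    and "\<forall>c>0. (\<lambda>_. c) \<in> E"
    and "gg_convex_cone (rv_in M E I)"
    and "pos_functional M (rv_power E) \<rho>"
  shows
    "(systemic_rrm M E I \<rho> \<longleftrightarrow>
       (\<exists>\<rho>0 \<Lambda>. pos_functional M (rv_in M E I) \<rho>0 \<and>
          is_composition M E (rv_in M E I) \<rho> \<rho>0 \<Lambda> \<and>
          return_aggregation M E I \<Lambda> \<and>
          ae_increasing_on M (rv_in M E I) \<rho>0 \<and>
          constancy_on I \<rho>0)) \<and>
     (gg_convex_systemic_rrm M E I \<rho> \<longleftrightarrow>
       (\<exists>\<rho>0 \<Lambda>. pos_functional M (rv_in M E I) \<rho>0 \<and>
          is_composition M E (rv_in M E I) \<rho> \<rho>0 \<Lambda> \<and>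
          gg_convex_return_aggregation M E I \<Lambda> \<and>
          ae_increasing_on M (rv_in M E I) \<rho>0 \<and>
          gg_convex_on (rv_mix gg_mix) (rv_in M E I) \<rho>0 \<and>
          constancy_on I \<rho>0)) \<and>
     (gg_coherent_systemic_rrm M E I \<rho> \<longleftrightarrow>
       (\<exists>\<rho>0 \<Lambda>. pos_functional M (rv_in M E I) \<rho>0 \<and>
          is_composition M E (rv_in M E I) \<rho> \<rho>0 \<Lambda> \<and>
          gg_coherent_return_aggregation M E I \<Lambda> \<and>
          ae_increasing_on M (rv_in M E I) \<rho>0 \<and>
          gg_convex_on (rv_mix gg_mix) (rv_in M E I) \<rho>0 \<and>
          pos_homogeneous_on rv_scale (rv_in M E I) \<rho>0 \<and>
          constancy_on I \<rho>0))"
proof -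
  interpret gg_domain M E I
    using assms by unfold_locales auto
  let ?F = "\<lambda>\<rho>0 \<Lambda>. pos_functional M (rv_in M E I) \<rho>0 \<and>
    is_composition M E (rv_in M E I) \<rho> \<rho>0 \<Lambda> \<and> return_aggregation M E I \<Lambda> \<and>
    ae_increasing_on M (rv_in M E I) \<rho>0 \<and> constancy_on I \<rho>0"
  let ?conv = "\<lambda>\<rho>0 \<Lambda>. gg_convex_on gg_mix_vec pos_orthant \<Lambda> \<and>
    gg_convex_on (rv_mix gg_mix) (rv_in M E I) \<rho>0"
  let ?hom = "\<lambda>\<rho>0 \<Lambda>. pos_homogeneous_on (*\<^sub>R) pos_orthant \<Lambda> \<and>
    pos_homogeneous_on rv_scale (rv_in M E I) \<rho>0"
  let ?convex = "gg_convex_on (rv_mix gg_mix_vec) (rv_power E) \<rho> \<and> risk_gg_convex M E \<rho>"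
  let ?homog = "pos_homogeneous_on rv_scale (rv_power E) \<rho>"
  have fact: "rrm_factorization M E I \<rho> \<rho>0 \<Lambda>" if "?F \<rho>0 \<Lambda>" for \<rho>0 \<Lambda>
    using that composition_rrm_factorization by blast
  have A: "systemic_rrm M E I \<rho> \<longleftrightarrow> (\<exists>\<rho>0 \<Lambda>. ?F \<rho>0 \<Lambda>)"
    using systemic_rrm_factorization fact rrm_factorization.systemic_rrm_composition assms(9)
    by metis
  \<comment> \<open>This holds for every factorization, not just for the constructed one. A witness
    from (A) therefore serves for (B) as well, and likewise for (C) by \<open>hom\<close>.\<close>
  have conv: "?convex \<longleftrightarrow> ?conv \<rho>0 \<Lambda>" if F: "?F \<rho>0 \<Lambda>" for \<rho>0 \<Lambda>
  proof -
    interpret rrm_factorization M E I \<rho> \<rho>0 \<Lambda> using F by (rule fact)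
    show ?thesis
      using F risk_gg_convex_iff gg_convex_aggregation gg_convex_composition by blast
  qed
  have hom: "?homog \<longleftrightarrow> ?hom \<rho>0 \<Lambda>" if F: "?F \<rho>0 \<Lambda>" for \<rho>0 \<Lambda>
    using fact[OF F] by (rule rrm_factorization.pos_homogeneous_iff)
  have B: "systemic_rrm M E I \<rho> \<and> ?convex \<longleftrightarrow> (\<exists>\<rho>0 \<Lambda>. ?F \<rho>0 \<Lambda> \<and> ?conv \<rho>0 \<Lambda>)"
    unfolding A using conv by blast
  have C: "(systemic_rrm M E I \<rho> \<and> ?convex) \<and> ?homog \<longleftrightarrow>
      (\<exists>\<rho>0 \<Lambda>. ?F \<rho>0 \<Lambda> \<and> ?conv \<rho>0 \<Lambda> \<and> ?hom \<rho>0 \<Lambda>)"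
    unfolding B using hom by blast
  show ?thesis
    unfolding gg_coherent_systemic_rrm_def gg_convex_systemic_rrm_def
      gg_coherent_return_aggregation_def gg_convex_return_aggregation_def C
    \<comment> \<open>With the definitions unfolded, (B) and (C) differ from the goal only in the
      order of conjuncts.\<close>
    unfolding B by (intro conjI A) (simp_all only: conj_ac)
qed

end
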